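(* Let $n \ge 1$ be an integer and let $U_1, \dots, U_n$ be independent random variables, each uniformly distributed on $[0,1]$. Then the probability that no three of the numbers $U_1,\dots,U_n$ can form a triangle (that is, that there are no three distinct indices $a,b,c \in \{1,\dots,n\}$ such that $U_a, U_b, U_c$ are the side lengths of a triangle) equals $$\prod_{i=1}^{n} \frac{1}{F_i},$$ where $(F_k)_{k\ge 1}$ are the Fibonacci numbers defined by $F_1 = 1$, $F_2 = 1$, and $F_k = F_{k-1} + F_{k-2}$ for $k > 2$.
   Context: Three nonnegative real numbers can form a triangle if each of them is strictly less than the sum of the other two. Equivalently, three numbers $x \le y \le z$ cannot form a triangle exactly when $x + y \le z$. *)

theory Defs
  imports "HOL-Probability.Probability" "HOL-Number_Theory.Fib"
begin

text \<open>The three strict inequalities already force all three numbers to be positive, so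
  nonnegativity is not a separate conjunct.\<close>

definition forms_triangle :: "real \<Rightarrow> real \<Rightarrow> real \<Rightarrow> bool" where
  "forms_triangle x y z \<longleftrightarrow> x < y + z \<and> y < x + z \<and> z < x + y"

end

theory Submission
  imports Defs
begin

text \<open>
  Let \<open>0 \<le> a \<le> b\<close> be two numbers and let \<open>k\<close> uniform points be added. The new points
  form no triangle among themselves or with \<open>a, b\<close>, and lie above \<open>a + b\<close>, iff the least new
  point \<open>c\<close> satisfies \<open>a + b \<le> c\<close> and the remaining \<open>k - 1\<close> points stand in the same relation to
  \<open>b, c\<close>. As each of the \<open>k\<close> points may be the least one, the probability \<open>W\<^sub>k\<close> satisfies
  \<open>W\<^sub>k(a, b) = k \<integral> W\<^sub>k\<^sub>-\<^sub>1(b, c) dc\<close> over \<open>[a + b, 1]\<close>, which is solved by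
  \<open>W\<^sub>k(a, b) = (1 - F\<^sub>k a - F\<^sub>k\<^sub>+\<^sub>1 b)\<^sub>+\<^sup>k / (F\<^sub>1 \<cdots> F\<^sub>k)\<close>. The theorem is the value at \<open>a = b = 0\<close>.
\<close>

section \<open>Removing and inserting the least point\<close>

text \<open>For \<open>0 \<le> a \<le> b\<close> the clauses also cover triples with
  \<open>a\<close>: the first excludes a triangle on \<open>a\<close>, \<open>b\<close>,
  \<open>x i\<close>, and a triangle on \<open>a\<close>, \<open>x i\<close>, \<open>x j\<close>
  would give one on \<open>b\<close>, \<open>x i\<close>, \<open>x j\<close>.\<close>

definition avoids :: "real \<Rightarrow> real \<Rightarrow> 'i set \<Rightarrow> ('i \<Rightarrow> real) \<Rightarrow> bool" where
  "avoids a b J x \<longleftrightarrow> (\<forall>i\<in>J. a + b \<le> x i) \<and>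
     (\<forall>i\<in>J. \<forall>j\<in>J. i \<noteq> j \<longrightarrow> \<not> forms_triangle b (x i) (x j)) \<and>
     (\<forall>i\<in>J. \<forall>j\<in>J. \<forall>k\<in>J. i \<noteq> j \<and> j \<noteq> k \<and> i \<noteq> k \<longrightarrow> \<not> forms_triangle (x i) (x j) (x k))"

lemma avoids_cong: "(\<And>i. i \<in> J \<Longrightarrow> x i = y i) \<Longrightarrow> avoids a b J x \<longleftrightarrow> avoids a b J y"
  by (simp add: avoids_def)

text \<open>Since \<open>b \<le> x m \<le> x i\<close>, the largest side is \<open>x i\<close>, so
  the absence of a triangle on these three means \<open>b + x m \<le> x i\<close>. Triples through
  \<open>m\<close> become the clause for the new second parameter \<open>x m\<close>.\<close>

lemma avoids_remove_min:
  assumes "avoids a b J x" "0 \<le> a" "0 \<le> b" "m \<in> J" "\<And>i. i \<in> J \<Longrightarrow> x m \<le> x i"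
  shows "avoids b (x m) (J - {m}) x"
proof -
  have "b + x m \<le> x i" if "i \<in> J" "i \<noteq> m" for i
  proof -
    have "\<not> forms_triangle b (x m) (x i)" "a + b \<le> x m" "x m \<le> x i"
      using assms that by (auto simp: avoids_def)
    then show ?thesis
      using assms(2,3) unfolding forms_triangle_def by linarith
  qed
  moreover have "\<not> forms_triangle (x m) (x i) (x j)"
    if "i \<in> J - {m}" "j \<in> J - {m}" "i \<noteq> j" for i j
    using assms(1,4) that by (auto simp: avoids_def)
  ultimately show ?thesis
    using assms(1) by (simp add: avoids_def)
qed

text \<open>The point \<open>x m\<close> is automatically least, because
  \<open>b + x m \<le> x i\<close>; the same bound excludes triangles on \<open>b\<close>,
  \<open>x m\<close>, \<open>x i\<close>. As \<open>b \<le> x m\<close>, a triangle on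
  \<open>b\<close> and two other points would give one on \<open>x m\<close> and these
  points.\<close>

lemma avoids_insert_min:
  assumes "avoids b (x m) (J - {m}) x" "0 \<le> a" "0 \<le> b" "a + b \<le> x m"
  shows "avoids a b J x"
proof -
  have low: "b + x m \<le> x i" if "i \<in> J" "i \<noteq> m" for i
    using assms(1) that by (auto simp: avoids_def)
  have tri: "\<not> forms_triangle (x m) (x i) (x j)"
    if "i \<in> J" "j \<in> J" "i \<noteq> m" "j \<noteq> m" "i \<noteq> j" for i j
    using assms(1) that by (auto simp: avoids_def)
  have "\<not> forms_triangle b (x i) (x j)" if "i \<in> J" "j \<in> J" "i \<noteq> j" for i j
  proof (cases "i = m \<or> j = m")
    case True
    then show ?thesis using low that unfolding forms_triangle_def by fastforce
  next
    case False
    then have "\<not> forms_triangle (x m) (x i) (x j)" "b + x m \<le> x i" "b + x m \<le> x j"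
      using tri low that by auto
    then show ?thesis
      using assms(2-4) unfolding forms_triangle_def by linarith
  qed
  moreover have "a + b \<le> x i" if "i \<in> J" for i
    using low[of i] that assms(2-4) by (cases "i = m") auto
  moreover have "\<not> forms_triangle (x i) (x j) (x k)"
    if "i \<in> J" "j \<in> J" "k \<in> J" "i \<noteq> j" "j \<noteq> k" "i \<noteq> k" for i j k
  proof (cases "i = m \<or> j = m \<or> k = m")
    case True
    then show ?thesis
      using that tri[of j k] tri[of i k] tri[of i j] by (auto simp: forms_triangle_def)
  next
    case False
    then show ?thesis using assms(1) that by (auto simp: avoids_def)
  qed
  ultimately show ?thesis by (auto simp: avoids_def)
qed

text \<open>The inequalities would give both \<open>y < z\<close> and \<open>z < y\<close>. Hence
  \<open>avoids 0 0\<close> only says that the points are nonnegative and triangle-free.\<close>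

lemma not_forms_triangle_0 [simp]: "\<not> forms_triangle 0 y z"
  by (simp add: forms_triangle_def)

text \<open>This bounds the measure at \<open>b = 0\<close> from below by the exact values known for
  \<open>0 < b\<close>.\<close>

lemma avoids_mono: "avoids 0 b J x \<Longrightarrow> 0 \<le> b \<Longrightarrow> avoids 0 0 J x"
  by (fastforce simp: avoids_def)

lemma ex_min_avoids:
  assumes "avoids a b J x" "0 \<le> a" "0 \<le> b" "finite J" "J \<noteq> {}"
  shows "\<exists>m\<in>J. a + b \<le> x m \<and> avoids b (x m) (J - {m}) x"
proof -
  obtain m where m: "m \<in> J" "\<And>i. i \<in> J \<Longrightarrow> x m \<le> x i"
    using arg_min_if_finite(1)[OF assms(4,5)] arg_min_least[OF assms(4,5)] by metis
  have "avoids b (x m) (J - {m}) x"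
    by (rule avoids_remove_min[OF assms(1-3) m])
  moreover have "a + b \<le> x m" using assms(1) m(1) by (simp add: avoids_def)
  ultimately show ?thesis using m(1) by blast
qed

section \<open>Uniform measure on the cube, measurability, and integration over the least
  coordinate\<close>

abbreviation unit_uniform :: "real measure" where
  "unit_uniform \<equiv> uniform_measure lborel {0..1}"

abbreviation cube :: "'i set \<Rightarrow> ('i \<Rightarrow> real) measure" where
  "cube J \<equiv> PiM J (\<lambda>_. unit_uniform)"

interpretation unit_uniform: prob_space unit_uniform
  by (rule prob_space_uniform_measure) auto

interpretation cube: product_sigma_finite "\<lambda>_. unit_uniform"
  by standard

text \<open>The second parameter varies with the sample point because removing the least point puts
  the random coordinate \<open>x m\<close> in its place.\<close>

lemma pred_avoids:
  assumes "finite J" and [measurable]: "b \<in> borel_measurable M"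
    and X: "\<And>i. i \<in> J \<Longrightarrow> (\<lambda>\<omega>. X \<omega> i) \<in> borel_measurable M"
  shows "Measurable.pred M (\<lambda>\<omega>. avoids a (b \<omega>) J (X \<omega>))"
proof -
  have tri: "Measurable.pred M (\<lambda>\<omega>. forms_triangle (f \<omega>) (g \<omega>) (h \<omega>))"
    if [measurable]: "f \<in> borel_measurable M" "g \<in> borel_measurable M" "h \<in> borel_measurable M"
    for f g h
    unfolding forms_triangle_def by measurable
  have low: "Measurable.pred M (\<lambda>\<omega>. a + b \<omega> \<le> X \<omega> i)" if "i \<in> J" for i
    using X[OF that] by measurable
  show ?thesis
    unfolding avoids_def
    by (intro pred_intros_logic(3) pred_intros_finite(3) pred_intros_imp' pred_intros_logic(2)
        assms(1) tri low assms(2) X; assumption)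
qed

lemma sets_cube: "sets (cube K) = sets (PiM K (\<lambda>_. borel))"
  by (intro sets_PiM_cong) auto

lemma space_cube: "space (cube K) = space (PiM K (\<lambda>_. borel))"
  by (rule sets_eq_imp_space_eq[OF sets_cube])

lemma cube_component: "i \<in> J \<Longrightarrow> (\<lambda>x. x i) \<in> borel_measurable (cube J)"
  unfolding measurable_cong_sets[OF sets_cube refl] by (rule measurable_component_singleton)

lemma sets_cube_avoids:
  assumes "finite J"
  shows "{x \<in> space (cube J). avoids a b J x} \<in> sets (cube J)"
  using assms by (intro predE pred_avoids cube_component) auto

lemma sets_cube_avoids_min:
  assumes "finite J" "m \<in> J"
  shows "{x \<in> space (cube J). a + b \<le> x m \<and> avoids b (x m) (J - {m}) x} \<in> sets (cube J)"
proof -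
  have [measurable]: "Measurable.pred (cube J) (\<lambda>x. avoids b (x m) (J - {m}) x)"
    using assms by (intro pred_avoids cube_component) auto
  have [measurable]: "(\<lambda>x. x m) \<in> borel_measurable (cube J)"
    by (rule cube_component[OF assms(2)])
  show ?thesis by measurable
qed

text \<open>Fubini in coordinate \<open>m\<close>: once \<open>x m = c\<close> is fixed, the event
  splits into a condition on \<open>c\<close> and an event in the other coordinates.\<close>

lemma emeasure_avoids_min:
  assumes "finite J" "m \<in> J"
  shows "emeasure (cube J) {x \<in> space (cube J). a + b \<le> x m \<and> avoids b (x m) (J - {m}) x} =
    (\<integral>\<^sup>+c. indicator {a + b..} c *
       emeasure (cube (J - {m})) {x \<in> space (cube (J - {m})). avoids b c (J - {m}) x} \<partial>unit_uniform)"
    (is "emeasure _ ?S = ?rhs")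
proof -
  have J: "insert m (J - {m}) = J" using assms by auto
  have S: "?S \<in> sets (cube J)" by (rule sets_cube_avoids_min[OF assms])
  have "emeasure (cube J) ?S = (\<integral>\<^sup>+x. indicator ?S x \<partial>cube (insert m (J - {m})))"
    using S J by simp
  also have "\<dots> = (\<integral>\<^sup>+c. \<integral>\<^sup>+x. indicator ?S (x(m := c)) \<partial>cube (J - {m}) \<partial>unit_uniform)"
    using assms(1) S J by (intro cube.product_nn_integral_insert_rev) auto
  also have "\<dots> = ?rhs"
  proof (intro nn_integral_cong)
    fix c
    let ?A = "{x \<in> space (cube (J - {m})). avoids b c (J - {m}) x}"
    have A: "?A \<in> sets (cube (J - {m}))"
      using assms(1) by (intro sets_cube_avoids) auto
    have "indicator ?S (x(m := c)) = indicator {a + b..} c * (indicator ?A x :: ennreal)"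
      if "x \<in> space (cube (J - {m}))" for x
    proof -
      have "x(m := c) \<in> space (cube J)"
        using that J by (auto simp: space_PiM PiE_def extensional_def)
      moreover have "avoids b c (J - {m}) (x(m := c)) \<longleftrightarrow> avoids b c (J - {m}) x"
        by (rule avoids_cong) auto
      ultimately show ?thesis using that by (auto simp: indicator_def)
    qed
    then have "(\<integral>\<^sup>+x. indicator ?S (x(m := c)) \<partial>cube (J - {m})) =
        (\<integral>\<^sup>+x. indicator {a + b..} c * indicator ?A x \<partial>cube (J - {m}))"
      by (intro nn_integral_cong)
    also have "\<dots> = indicator {a + b..} c * emeasure (cube (J - {m})) ?A"
      using A by (simp add: nn_integral_cmult_indicator)
    finally show "(\<integral>\<^sup>+x. indicator ?S (x(m := c)) \<partial>cube (J - {m})) = \<dots>" .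
  qed
  finally show ?thesis .
qed

section \<open>The volume formula and its integral recursion\<close>

text \<open>The case distinction, rather than a positive part, matters for \<open>k = 0\<close>, where
  \<open>0 ^ 0 = 1\<close>.\<close>

definition fib_volume :: "nat \<Rightarrow> real \<Rightarrow> real \<Rightarrow> real" where
  "fib_volume k a b = (let t = 1 - real (fib k) * a - real (fib (Suc k)) * b in
     if 0 \<le> t then (\<Prod>i=1..k. 1 / real (fib i)) * t ^ k else 0)"

text \<open>In \<open>c\<close> the integrand is \<open>K * (u - p * c) ^ k\<close> up to its zero.
  Integration divides by \<open>p * Suc k\<close>: the factor \<open>1 / p\<close> extends the
  product of reciprocals, and \<open>Suc k\<close> cancels the factor in front.\<close>

lemma nn_integral_fib_volume:
  assumes "0 \<le> a" "0 \<le> b"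
  shows "of_nat (Suc k) * (\<integral>\<^sup>+c. indicator {a + b..} c * ennreal (fib_volume k b c) \<partial>unit_uniform)
    = ennreal (fib_volume (Suc k) a b)"
proof -
  define p where "p = real (fib (Suc k))"
  define u where "u = 1 - real (fib k) * b"
  define K where "K = (\<Prod>i=1..k. 1 / real (fib i))"
  have p: "p \<ge> 1" unfolding p_def using fib_neq_0_nat[of "Suc k"] by linarith
  have K: "K \<ge> 0" unfolding K_def by (intro prod_nonneg) auto
  have u: "u \<le> 1" unfolding u_def using assms by auto
  \<comment> \<open>The integrand is cut off at \<open>u / p\<close>; as this is at most 1, the
    restriction of \<open>c\<close> to the unit interval does not shorten the range.\<close>
  have top: "u / p \<le> 1" using p u by (simp add: divide_simps)
  \<comment> \<open>At the lower limit \<open>c = a + b\<close> the Fibonacci recurrence merges the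
    two coefficients of \<open>b\<close> into \<open>fib (Suc (Suc k))\<close>.\<close>
  have t: "1 - real (fib (Suc k)) * a - real (fib (Suc (Suc k))) * b = u - p * (a + b)"
    by (simp add: p_def u_def algebra_simps)
  have eq: "indicator {a + b..} c * ennreal (fib_volume k b c) * indicator {0..1} c =
     ennreal (K * (u - p * c) ^ k) * indicator {a + b..u / p} c" for c
  proof -
    have "c \<le> u / p \<longleftrightarrow> 0 \<le> u - p * c" using p by (simp add: field_simps)
    then show ?thesis
      using assms top
      by (auto simp: fib_volume_def Let_def indicator_def K_def u_def p_def)
  qed
  have "(\<integral>\<^sup>+c. indicator {a + b..} c * ennreal (fib_volume k b c) \<partial>unit_uniform) =
     (\<integral>\<^sup>+c. indicator {a + b..} c * ennreal (fib_volume k b c) * indicator {0..1} c \<partial>lborel)"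
    by (subst nn_integral_uniform_measure) (auto simp: fib_volume_def Let_def divide_ennreal_def)
  also have "\<dots> = (\<integral>\<^sup>+c. ennreal (K * (u - p * c) ^ k) * indicator {a + b..u / p} c \<partial>lborel)"
    by (simp only: eq)
  also have "\<dots> = ennreal (fib_volume (Suc k) a b / real (Suc k))"
  proof (cases "a + b \<le> u / p")
    case True
    \<comment> \<open>This antiderivative vanishes at the upper limit \<open>u / p\<close>, so only
      the lower limit contributes.\<close>
    let ?F = "\<lambda>c. - K / (p * real (Suc k)) * (u - p * c) ^ Suc k"
    have "(\<integral>\<^sup>+c. ennreal (K * (u - p * c) ^ k) * indicator {a + b..u / p} c \<partial>lborel) =
        ennreal (?F (u / p) - ?F (a + b))"
    proof (rule nn_integral_FTC_Icc[OF _ _ _ True])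
      fix c
      have "((\<lambda>c. u - p * c) has_real_derivative - p) (at c)"
        by (auto intro!: derivative_eq_intros)
      from DERIV_cmult[OF DERIV_power[OF this, of "Suc k"], of "- K / (p * real (Suc k))"]
      show "(?F has_real_derivative K * (u - p * c) ^ k) (at c)"
        by (rule DERIV_cong) (use p in \<open>simp del: of_nat_Suc\<close>)
      show "0 \<le> K * (u - p * c) ^ k" if "c \<in> {a + b..u / p}"
        using K p that by (intro mult_nonneg_nonneg zero_le_power) (auto simp: field_simps)
    qed auto
    also have "?F (u / p) - ?F (a + b) = fib_volume (Suc k) a b / real (Suc k)"
    proof -
      have "0 \<le> u - p * (a + b)" using True p by (simp add: field_simps)
      then have "fib_volume (Suc k) a b = K / p * (u - p * (a + b)) ^ Suc k"
        unfolding fib_volume_def t Let_def by (simp add: K_def p_def)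
      then show ?thesis using p by (simp del: of_nat_Suc power_Suc)
    qed
    finally show ?thesis .
  next
    case False
    then have "\<not> 0 \<le> u - p * (a + b)" using p by (simp add: field_simps)
    with False show ?thesis unfolding fib_volume_def t Let_def by simp
  qed
  finally show ?thesis
    by (simp add: ennreal_of_nat_eq_real_of_nat del: of_nat_Suc flip: ennreal_mult')
qed

section \<open>Induction on the number of points\<close>

lemma AE_unit_uniform: "AE c in unit_uniform. 0 \<le> c \<and> c \<le> 1"
  by (rule AE_uniform_measureI) auto

text \<open>For \<open>b = 0\<close> two points may tie for the minimum, so the events indexed by the minimal point
  are disjoint only if \<open>0 < b\<close>; the subadditive bound holds regardless. The reverse inequality at
  \<open>b = 0\<close> is obtained by letting \<open>b\<close> tend to \<open>0\<close>.\<close>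

lemma emeasure_avoids:
  assumes "finite J" "0 \<le> a" "0 \<le> b" "b \<le> 1"
  shows "emeasure (cube J) {x \<in> space (cube J). avoids a b J x} \<le> ennreal (fib_volume (card J) a b) \<and>
    (0 < b \<longrightarrow> emeasure (cube J) {x \<in> space (cube J). avoids a b J x} = ennreal (fib_volume (card J) a b))"
  using assms
proof (induction "card J" arbitrary: J a b)
  case 0
  then have "J = {}" by simp
  \<comment> \<open>The event has measure 1, and since \<open>fib 0 = 0\<close> the formula gives 1
    exactly when \<open>b \<le> 1\<close>.\<close>
  with 0 show ?case
    by (simp add: avoids_def fib_volume_def Let_def space_PiM_empty PiM_empty)
next
  case (Suc k)
  let ?N = "{x \<in> space (cube J). avoids a b J x}"
  let ?S = "\<lambda>m. {x \<in> space (cube J). a + b \<le> x m \<and> avoids b (x m) (J - {m}) x}"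
  let ?E = "\<lambda>m c. emeasure (cube (J - {m})) {x \<in> space (cube (J - {m})). avoids b c (J - {m}) x}"
  let ?I = "\<integral>\<^sup>+c. indicator {a + b..} c * ennreal (fib_volume k b c) \<partial>unit_uniform"
  have J: "J \<noteq> {}" using Suc.hyps(2) by auto
  have N: "?N = (\<Union>m\<in>J. ?S m)"
  proof (intro equalityI subsetI)
    fix x assume "x \<in> ?N"
    then show "x \<in> (\<Union>m\<in>J. ?S m)"
      using ex_min_avoids[OF _ Suc.prems(2,3,1) J, of x] by simp
  next
    fix x assume "x \<in> (\<Union>m\<in>J. ?S m)"
    then obtain m where m: "x \<in> ?S m" by (rule UN_E)
    then have "avoids a b J x"
      using Suc.prems(2,3) by (intro avoids_insert_min[of b x m]) auto
    with m show "x \<in> ?N" by simp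
  qed
  have S: "?S ` J \<subseteq> sets (cube J)"
    using sets_cube_avoids_min[OF Suc.prems(1)] by blast
  have card: "k = card (J - {m})" if "m \<in> J" for m
    using Suc.hyps(2) Suc.prems(1) that by simp
  have IH: "?E m c \<le> ennreal (fib_volume k b c) \<and> (0 < c \<longrightarrow> ?E m c = ennreal (fib_volume k b c))"
    if "m \<in> J" "0 \<le> c" "c \<le> 1" for m c
    using Suc.hyps(1)[OF card[OF that(1)], of b c] Suc.prems that card[OF that(1)] by simp
  have le: "emeasure (cube J) (?S m) \<le> ?I" if "m \<in> J" for m
    unfolding emeasure_avoids_min[OF Suc.prems(1) that]
    by (rule nn_integral_mono_AE, rule AE_mp[OF AE_unit_uniform])
      (auto intro!: AE_I2 mult_left_mono simp: IH[OF that])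
  \<comment> \<open>Where the indicator is nonzero, \<open>0 < b \<le> a + b \<le> c\<close>, so the
    equality half of the induction hypothesis applies; its bound \<open>c \<le> 1\<close> holds
    almost everywhere.\<close>
  have eq: "emeasure (cube J) (?S m) = ?I" if "m \<in> J" "0 < b" for m
    unfolding emeasure_avoids_min[OF Suc.prems(1) that(1)]
    by (rule nn_integral_cong_AE, rule AE_mp[OF AE_unit_uniform])
      (use that Suc.prems(2) in \<open>auto intro!: AE_I2 simp: IH[OF that(1)] indicator_def\<close>)
  have vol: "of_nat (card J) * ?I = ennreal (fib_volume (card J) a b)"
    using nn_integral_fib_volume[OF Suc.prems(2,3), of k] Suc.hyps(2) by simp
  have "emeasure (cube J) ?N \<le> (\<Sum>m\<in>J. emeasure (cube J) (?S m))"
    unfolding N by (rule emeasure_subadditive_finite[OF Suc.prems(1) S])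
  also have "\<dots> \<le> (\<Sum>m\<in>J. ?I)" by (rule sum_mono) (rule le)
  finally have "emeasure (cube J) ?N \<le> ennreal (fib_volume (card J) a b)"
    using vol by simp
  moreover have "emeasure (cube J) ?N = ennreal (fib_volume (card J) a b)" if b: "0 < b"
  proof -
    have "disjoint_family_on ?S J"
    unfolding disjoint_family_on_def
    proof (intro ballI impI)
      fix m m' assume *: "m \<in> J" "m' \<in> J" "m \<noteq> m'"
      have "b + x m \<le> x m'" "b + x m' \<le> x m" if "x \<in> ?S m \<inter> ?S m'" for x
        using that * by (auto simp: avoids_def)
      with b show "?S m \<inter> ?S m' = {}" by fastforce
    qed
    then have "emeasure (cube J) ?N = (\<Sum>m\<in>J. emeasure (cube J) (?S m))"
      unfolding N by (intro sum_emeasure[symmetric] S Suc.prems(1))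
    also have "\<dots> = (\<Sum>m\<in>J. ?I)" using eq[OF _ b] by (intro sum.cong) auto
    finally show ?thesis using vol by simp
  qed
  ultimately show ?case by blast
qed

section \<open>The limit at the origin\<close>

lemma emeasure_avoids_0_0:
  assumes "finite J"
  shows "emeasure (cube J) {x \<in> space (cube J). avoids 0 0 J x} =
    ennreal (\<Prod>i=1..card J. 1 / real (fib i))"
proof (rule antisym)
  let ?k = "card J" and ?K = "\<Prod>i=1..card J. 1 / real (fib i)"
  let ?N = "\<lambda>b. {x \<in> space (cube J). avoids 0 b J x}"
  show "emeasure (cube J) (?N 0) \<le> ennreal ?K"
    using emeasure_avoids[OF assms, of 0 0] by (simp add: fib_volume_def Let_def)
  have "((\<lambda>b. ennreal (?K * (1 - real (fib (Suc ?k)) * b) ^ ?k)) \<longlongrightarrow>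
      ennreal (?K * (1 - real (fib (Suc ?k)) * 0) ^ ?k)) (at_right 0)"
    by (intro tendsto_intros)
  then have lim: "((\<lambda>b. ennreal (?K * (1 - real (fib (Suc ?k)) * b) ^ ?k)) \<longlongrightarrow> ennreal ?K) (at_right 0)"
    by simp
  \<comment> \<open>Below \<open>?r\<close> the base \<open>1 - fib (Suc ?k) * b\<close> is
    positive, so the polynomial branch of \<open>fib_volume\<close> applies; also
    \<open>b \<le> 1\<close>, because \<open>fib (Suc ?k) \<ge> 1\<close>.\<close>
  let ?r = "1 / real (fib (Suc ?k))"
  have f: "1 \<le> real (fib (Suc ?k))" using fib_neq_0_nat[of "Suc ?k"] by linarith
  have "eventually (\<lambda>b. b \<in> {0<..<?r}) (at_right 0)"
    using f by (intro eventually_at_right_real) auto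
  then have "eventually (\<lambda>b. ennreal (?K * (1 - real (fib (Suc ?k)) * b) ^ ?k) \<le> emeasure (cube J) (?N 0)) (at_right 0)"
  proof eventually_elim
    case (elim b)
    have "real (fib (Suc ?k)) * b \<le> 1" using elim f by (simp add: field_simps)
    moreover have "b \<le> real (fib (Suc ?k)) * b" using elim f by simp
    ultimately have "ennreal (?K * (1 - real (fib (Suc ?k)) * b) ^ ?k) = emeasure (cube J) (?N b)"
      using emeasure_avoids[OF assms, of 0 b] elim by (simp add: fib_volume_def Let_def)
    also have "\<dots> \<le> emeasure (cube J) (?N 0)"
      using elim sets_cube_avoids[OF assms]
      by (intro emeasure_mono) (auto intro: avoids_mono)
    finally show ?case .
  qed
  then show "ennreal ?K \<le> emeasure (cube J) (?N 0)"
    by (rule tendsto_upperbound[OF lim]) simp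
qed

section \<open>Transfer from the cube to independent random variables\<close>

theorem theorem1:
  fixes M :: "'a measure" and U :: "nat \<Rightarrow> 'a \<Rightarrow> real" and n :: nat
  assumes "prob_space M"
    and "n \<ge> 1"
    and "prob_space.indep_vars M (\<lambda>_. borel) U {1..n}"
    and "\<And>i. i \<in> {1..n} \<Longrightarrow> distr M borel (U i) = uniform_measure lborel {0..1}"
  shows "measure M {\<omega> \<in> space M. \<not> (\<exists>a\<in>{1..n}. \<exists>b\<in>{1..n}. \<exists>c\<in>{1..n}.
            a \<noteq> b \<and> b \<noteq> c \<and> a \<noteq> c \<and> forms_triangle (U a \<omega>) (U b \<omega>) (U c \<omega>))}
         = (\<Prod>i=1..n. 1 / real (fib i))"
proof -
  interpret prob_space M by fact
  let ?J = "{1..n}"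
  let ?E = "{\<omega> \<in> space M. \<not> (\<exists>a\<in>?J. \<exists>b\<in>?J. \<exists>c\<in>?J.
            a \<noteq> b \<and> b \<noteq> c \<and> a \<noteq> c \<and> forms_triangle (U a \<omega>) (U b \<omega>) (U c \<omega>))}"
  let ?X = "\<lambda>\<omega>. \<lambda>i\<in>?J. U i \<omega>"
  let ?P = "PiM ?J (\<lambda>_. borel :: real measure)"
  let ?N = "{x \<in> space (cube ?J). avoids 0 0 ?J x}"
  have U [measurable]: "U i \<in> borel_measurable M" if "i \<in> ?J" for i
    using assms(3) that by (auto simp: indep_vars_def)
  \<comment> \<open>Independence makes the joint law the product of the marginals;
    \<open>n \<ge> 1\<close> supplies the nonempty index set this characterisation asks for.\<close>
  have distr: "distr M ?P ?X = cube ?J"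
  proof -
    have "distr M ?P ?X = PiM ?J (\<lambda>i. distr M borel (U i))"
      using assms(2,3) U by (subst indep_vars_iff_distr_eq_PiM'[symmetric]) auto
    also have "\<dots> = cube ?J" by (intro PiM_cong) (auto simp: assms(4))
    finally show ?thesis .
  qed
  have X: "?X \<in> measurable M ?P" by measurable
  have N: "?N \<in> sets ?P" using sets_cube_avoids[of ?J 0 0] by (simp add: sets_cube)
  \<comment> \<open>The event \<open>avoids 0 0\<close> also demands nonnegative coordinates, which
    \<open>U\<close> guarantees only almost surely; the two events are therefore compared up to a
    null set.\<close>
  have "AE \<omega> in M. 0 \<le> U i \<omega>" if "i \<in> ?J" for i
  proof -
    have "AE c in distr M borel (U i). 0 \<le> c"
      unfolding assms(4)[OF that] using AE_unit_uniform by auto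
    then show ?thesis using U[OF that] by (subst (asm) AE_distr_iff) auto
  qed
  then have nonneg: "AE \<omega> in M. \<forall>i\<in>?J. 0 \<le> U i \<omega>"
    by (simp add: AE_finite_all)
  have avoids: "?X \<omega> \<in> ?N \<longleftrightarrow> \<omega> \<in> ?E" if "\<omega> \<in> space M" "\<forall>i\<in>?J. 0 \<le> U i \<omega>" for \<omega>
  proof -
    have "?X \<omega> \<in> space (cube ?J)"
      using measurable_space[OF X that(1)] by (simp add: space_cube)
    moreover have "avoids 0 0 ?J (?X \<omega>) \<longleftrightarrow> avoids 0 0 ?J (\<lambda>i. U i \<omega>)"
      by (rule avoids_cong) auto
    moreover have "avoids 0 0 ?J (\<lambda>i. U i \<omega>) \<longleftrightarrow> (\<forall>i\<in>?J. \<forall>j\<in>?J. \<forall>k\<in>?J.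
        i \<noteq> j \<and> j \<noteq> k \<and> i \<noteq> k \<longrightarrow> \<not> forms_triangle (U i \<omega>) (U j \<omega>) (U k \<omega>))"
      using that(2) by (simp add: avoids_def)
    ultimately show ?thesis
      using that(1) by blast
  qed
  have "measure M ?E = measure M (?X -` ?N \<inter> space M)"
  proof (rule measure_eq_AE)
    show "AE \<omega> in M. \<omega> \<in> ?E \<longleftrightarrow> \<omega> \<in> ?X -` ?N \<inter> space M"
      using nonneg AE_space by eventually_elim (use avoids in blast)
    show "?E \<in> sets M" unfolding forms_triangle_def by measurable
    show "?X -` ?N \<inter> space M \<in> sets M" by (rule measurable_sets[OF X N])
  qed
  also have "\<dots> = measure (cube ?J) ?N"
    unfolding distr[symmetric] by (rule measure_distr[OF X, symmetric]) (use N distr in auto)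
  also have "\<dots> = (\<Prod>i=1..n. 1 / real (fib i))"
    using emeasure_avoids_0_0[of ?J]
    by (simp add: measure_def enn2real_ennreal prod_nonneg)
  finally show ?thesis .
qed

end
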